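(* Assume that the stationary measure $\mu$ is equivalent to $m$, and that for all $t\in\mathbb{R}$ the spectral radius of $P_{it}$ on $\mathcal{B}$ is at most $1$ and the essential spectral radius of $P_{it}$ on $\mathcal{B}$ is strictly less than $1$. If $\varphi$ is not aperiodic, then there exist $t\ne0$, $\lambda\in\mathbb{C}$ with $|\lambda|=1$ and a measurable function $g:X\to\mathbb{C}$, not $m$-a.e. equal to $0$, such that $gh\in\mathcal{B}$ and $$\lambda\,g(T_\omega x)=e^{it\varphi(x)}g(x)$$ for $m$-a.e. $x$ and $\mathbb{P}$-a.e. $\omega$.
   Context: Random system. $(\Omega,\mathcal{T},\mathbb{P})$ and $(X,\mathcal{A},m)$ are probability spaces; to each $\omega\in\Omega$ is associated a map $T_\omega:X\to X$, with $(\omega,x)\mapsto T_\omega(x)$ measurable and each $T_\omega$ non-singular with respect to $m$ (i.e. $m(A)=0$ implies $m(T_\omega^{-1}A)=0$). The transfer operator $P_\omega$ of $T_\omega$ acts on $L^1(m)$ and is characterized by $\int_X P_\omega f\, g\,dm=\int_X f\,(g\circ T_\omega)\,dm$ for $f\in L^1(m)$, $g\in L^\infty(m)$. The annealed transfer operator is $Pf(x)=\int_\Omega P_\omega f(x)\,d\mathbb{P}(\omega)$ on $L^1(m)$. A probability measure $\mu$ on $X$ is stationary if $\mu(A)=\int_\Omega\mu(T_\omega^{-1}A)\,d\mathbb{P}(\omega)$ for all $A\in\mathcal{A}$. Standing assumptions. There is a Banach space $(\mathcal{B},\|\cdot\|)$ of complex-valued functions such that: (1) $\mathcal{B}$ is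 compactly embedded in $L^1(m)$; (2) constant functions lie in $\mathcal{B}$; (3) $\mathcal{B}$ is a complex Banach lattice: $|f|,\bar f\in\mathcal{B}$ for all $f\in\mathcal{B}$; (4) $P(\mathcal{B})\subset\mathcal{B}$ and $P$ acts continuously on $\mathcal{B}$; (5) there are $N\ge1$, $\rho<1$, $K\ge0$ with $\|P^Nf\|\le\rho\|f\|+K\|f\|_{L^1(m)}$ for all $f\in\mathcal{B}$; (6) $1$ is a simple isolated eigenvalue of $P$ on $\mathcal{B}$ and there is no other eigenvalue on the unit circle. Then there is a unique stationary probability measure absolutely continuous with respect to $m$, denoted $\mu$, with density $h\in\mathcal{B}$, $Ph=h$. There is also a Banach space $\mathcal{B}_0\subset L^1(m)$ with norm $\|\cdot\|_0$ and a constant $C>0$ with $\|fg\|\le C\|f\|_0\|g\|$ for all $f\in\mathcal{B}_0$, $g\in\mathcal{B}$. $\varphi\in\mathcal{B}_0$ is a bounded real function with $\int_X\varphi\,d\mu=0$. For $z\in\mathbb{C}$, $P_z$ is the bounded operator on $\mathcal{B}$ given by $P_z(f)=P(e^{z\varphi}f)$. The observable $\varphi$ is aperiodic if for all real $t\ne0$ the spectral radius of $P_{it}$ on $\mathcal{B}$ is strictly less than $1$. *)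

theory Defs
  imports "HOL-Probability.Probability"
begin

section \<open>Banach spaces of integrable functions modulo null sets\<close>

text \<open>
  Elements of \<open>L\<^sup>1(m)\<close> are represented by integrable functions. A Banach space contained in
  \<open>L\<^sup>1(m)\<close> is represented by the set \<open>V\<close> of all representatives of its elements, so \<open>V\<close> is closed
  under changing a function on a null set, and the norm \<open>nrm\<close> is a seminorm on \<open>V\<close> that vanishes
  exactly on the functions that are zero almost everywhere.
\<close>

definition complex_subspace :: "('x \<Rightarrow> complex) set \<Rightarrow> bool" where
  "complex_subspace V \<longleftrightarrow>
     (\<lambda>x. 0) \<in> V \<and>
     (\<forall>f\<in>V. \<forall>g\<in>V. (\<lambda>x. f x + g x) \<in> V) \<and>
     (\<forall>c. \<forall>f\<in>V. (\<lambda>x. c * f x) \<in> V)"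

definition L1_norm :: "'x measure \<Rightarrow> ('x \<Rightarrow> complex) \<Rightarrow> real" where
  "L1_norm m f = (\<integral>x. cmod (f x) \<partial>m)"

definition banach_in_L1 ::
    "'x measure \<Rightarrow> ('x \<Rightarrow> complex) set \<Rightarrow> (('x \<Rightarrow> complex) \<Rightarrow> real) \<Rightarrow> bool" where
  "banach_in_L1 m V nrm \<longleftrightarrow>
     (\<forall>f\<in>V. integrable m f) \<and>
     (\<forall>f\<in>V. \<forall>g\<in>borel_measurable m. (AE x in m. g x = f x) \<longrightarrow> g \<in> V \<and> nrm g = nrm f) \<and>
     complex_subspace V \<and>
     (\<forall>f\<in>V. 0 \<le> nrm f \<and> (nrm f = 0 \<longleftrightarrow> (AE x in m. f x = 0))) \<and>
     (\<forall>c. \<forall>f\<in>V. nrm (\<lambda>x. c * f x) = cmod c * nrm f) \<and>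
     (\<forall>f\<in>V. \<forall>g\<in>V. nrm (\<lambda>x. f x + g x) \<le> nrm f + nrm g) \<and>
     (\<forall>u. (\<forall>n::nat. u n \<in> V) \<and>
          (\<forall>e>0. \<exists>M. \<forall>i\<ge>M. \<forall>j\<ge>M. nrm (\<lambda>x. u i x - u j x) < e) \<longrightarrow>
          (\<exists>l\<in>V. (\<lambda>n. nrm (\<lambda>x. u n x - l x)) \<longlonglongrightarrow> 0))"

definition compactly_embedded_in_L1 ::
    "'x measure \<Rightarrow> ('x \<Rightarrow> complex) set \<Rightarrow> (('x \<Rightarrow> complex) \<Rightarrow> real) \<Rightarrow> bool" where
  "compactly_embedded_in_L1 m V nrm \<longleftrightarrow>
     (\<forall>f\<in>V. integrable m f) \<and>
     (\<forall>u. (\<forall>n::nat. u n \<in> V \<and> nrm (u n) \<le> 1) \<longrightarrow>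
        (\<exists>r l. strict_mono r \<and> integrable m l \<and>
           (\<lambda>n. L1_norm m (\<lambda>x. u (r n) x - l x)) \<longlonglongrightarrow> 0))"

section \<open>Spectral notions\<close>

text \<open>
  Below, \<open>V\<close> is a space of functions with seminorm \<open>nrm\<close>, functions at distance \<open>0\<close> being identified,
  and \<open>A\<close> is an operator mapping \<open>V\<close> into itself. A point belongs to the resolvent set if
  \<open>\<zeta> - A\<close> is a bijection of \<open>V\<close> (modulo this identification) with bounded inverse; the bound in the
  second conjunct also yields injectivity.
\<close>

definition op_shift ::
    "(('x \<Rightarrow> complex) \<Rightarrow> 'x \<Rightarrow> complex) \<Rightarrow> complex \<Rightarrow> ('x \<Rightarrow> complex) \<Rightarrow> 'x \<Rightarrow> complex" where
  "op_shift A \<zeta> f = (\<lambda>x. \<zeta> * f x - A f x)"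

definition resolvent_set ::
    "('x \<Rightarrow> complex) set \<Rightarrow> (('x \<Rightarrow> complex) \<Rightarrow> real) \<Rightarrow>
     (('x \<Rightarrow> complex) \<Rightarrow> 'x \<Rightarrow> complex) \<Rightarrow> complex set" where
  "resolvent_set V nrm A = {\<zeta>.
     (\<forall>g\<in>V. \<exists>f\<in>V. nrm (\<lambda>x. op_shift A \<zeta> f x - g x) = 0) \<and>
     (\<exists>c. \<forall>f\<in>V. nrm f \<le> c * nrm (op_shift A \<zeta> f))}"

definition op_spectrum ::
    "('x \<Rightarrow> complex) set \<Rightarrow> (('x \<Rightarrow> complex) \<Rightarrow> real) \<Rightarrow>
     (('x \<Rightarrow> complex) \<Rightarrow> 'x \<Rightarrow> complex) \<Rightarrow> complex set" where
  "op_spectrum V nrm A = - resolvent_set V nrm A"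

definition op_spectral_radius ::
    "('x \<Rightarrow> complex) set \<Rightarrow> (('x \<Rightarrow> complex) \<Rightarrow> real) \<Rightarrow>
     (('x \<Rightarrow> complex) \<Rightarrow> 'x \<Rightarrow> complex) \<Rightarrow> ennreal" where
  "op_spectral_radius V nrm A = (SUP \<zeta>\<in>op_spectrum V nrm A. ennreal (cmod \<zeta>))"

definition op_eigenvalue ::
    "('x \<Rightarrow> complex) set \<Rightarrow> (('x \<Rightarrow> complex) \<Rightarrow> real) \<Rightarrow>
     (('x \<Rightarrow> complex) \<Rightarrow> 'x \<Rightarrow> complex) \<Rightarrow> complex \<Rightarrow> bool" where
  "op_eigenvalue V nrm A \<zeta> \<longleftrightarrow> (\<exists>f\<in>V. nrm f \<noteq> 0 \<and> nrm (op_shift A \<zeta> f) = 0)"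

definition isolated_eigenvalue ::
    "('x \<Rightarrow> complex) set \<Rightarrow> (('x \<Rightarrow> complex) \<Rightarrow> real) \<Rightarrow>
     (('x \<Rightarrow> complex) \<Rightarrow> 'x \<Rightarrow> complex) \<Rightarrow> complex \<Rightarrow> bool" where
  "isolated_eigenvalue V nrm A \<zeta> \<longleftrightarrow>
     op_eigenvalue V nrm A \<zeta> \<and>
     (\<exists>e>0. \<forall>\<kappa>\<in>op_spectrum V nrm A. \<kappa> \<noteq> \<zeta> \<longrightarrow> e \<le> cmod (\<kappa> - \<zeta>))"

definition has_dim ::
    "('x \<Rightarrow> complex) set \<Rightarrow> (('x \<Rightarrow> complex) \<Rightarrow> real) \<Rightarrow> nat \<Rightarrow> bool" where
  "has_dim E nrm n \<longleftrightarrow>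
     (\<exists>b. (\<forall>i<n. b i \<in> E) \<and>
          (\<forall>f\<in>E. \<exists>c. nrm (\<lambda>x. f x - (\<Sum>i<n. c i * b i x)) = 0) \<and>
          (\<forall>c. nrm (\<lambda>x. \<Sum>i<n. c i * b i x) = 0 \<longrightarrow> (\<forall>i<n. c i = 0)))"

text \<open>
  The algebraic multiplicity of an isolated point \<open>\<zeta>\<close> of the spectrum is the dimension of the range
  \<open>E\<close> of its spectral projection, whose kernel is \<open>F\<close>: both are closed and invariant, \<open>\<zeta> - A\<close> is
  nilpotent on \<open>E\<close> (when \<open>E\<close> is finite dimensional) and invertible on \<open>F\<close>. The dimension of the union
  of the kernels of the powers of \<open>\<zeta> - A\<close> would not do, since it can be finite when \<open>E\<close> is not.
\<close>

definition has_algebraic_multiplicity ::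
    "('x \<Rightarrow> complex) set \<Rightarrow> (('x \<Rightarrow> complex) \<Rightarrow> real) \<Rightarrow>
     (('x \<Rightarrow> complex) \<Rightarrow> 'x \<Rightarrow> complex) \<Rightarrow> complex \<Rightarrow> nat \<Rightarrow> bool" where
  "has_algebraic_multiplicity V nrm A \<zeta> n \<longleftrightarrow>
     (\<exists>E F. complex_subspace E \<and> E \<subseteq> V \<and> A ` E \<subseteq> E \<and>
        complex_subspace F \<and> F \<subseteq> V \<and> A ` F \<subseteq> F \<and>
        (\<forall>u. \<forall>l\<in>V. (\<forall>k::nat. u k \<in> F) \<and> (\<lambda>k. nrm (\<lambda>x. u k x - l x)) \<longlonglongrightarrow> 0 \<longrightarrow> l \<in> F) \<and>
        (\<forall>f\<in>V. \<exists>a\<in>E. \<exists>b\<in>F. nrm (\<lambda>x. f x - (a x + b x)) = 0) \<and>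
        (\<forall>f\<in>E \<inter> F. nrm f = 0) \<and>
        has_dim E nrm n \<and>
        (\<forall>f\<in>E. nrm ((op_shift A \<zeta> ^^ n) f) = 0) \<and>
        \<zeta> \<in> resolvent_set F nrm A)"

text \<open>
  The essential spectral radius is the smallest \<open>r \<ge> 0\<close> such that the part of the spectrum outside
  the closed disc of radius \<open>r\<close> consists of isolated eigenvalues of finite algebraic multiplicity.
\<close>

definition op_essential_spectrum ::
    "('x \<Rightarrow> complex) set \<Rightarrow> (('x \<Rightarrow> complex) \<Rightarrow> real) \<Rightarrow>
     (('x \<Rightarrow> complex) \<Rightarrow> 'x \<Rightarrow> complex) \<Rightarrow> complex set" where
  "op_essential_spectrum V nrm A =
     op_spectrum V nrm A -
     {\<zeta>. isolated_eigenvalue V nrm A \<zeta> \<and> (\<exists>n. has_algebraic_multiplicity V nrm A \<zeta> n)}"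

definition op_essential_spectral_radius ::
    "('x \<Rightarrow> complex) set \<Rightarrow> (('x \<Rightarrow> complex) \<Rightarrow> real) \<Rightarrow>
     (('x \<Rightarrow> complex) \<Rightarrow> 'x \<Rightarrow> complex) \<Rightarrow> ennreal" where
  "op_essential_spectral_radius V nrm A =
     (SUP \<zeta>\<in>op_essential_spectrum V nrm A. ennreal (cmod \<zeta>))"

section \<open>Random systems and annealed transfer operators\<close>

definition nonsingular_map :: "'x measure \<Rightarrow> ('x \<Rightarrow> 'x) \<Rightarrow> bool" where
  "nonsingular_map m S \<longleftrightarrow>
     S \<in> measurable m m \<and> (\<forall>A\<in>null_sets m. S -` A \<inter> space m \<in> null_sets m)"

text \<open>An operator on representatives; the identity determines \<open>L f\<close> up to a null set.\<close>

definition transfer_operator ::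
    "'x measure \<Rightarrow> ('x \<Rightarrow> 'x) \<Rightarrow> (('x \<Rightarrow> complex) \<Rightarrow> 'x \<Rightarrow> complex) \<Rightarrow> bool" where
  "transfer_operator m S L \<longleftrightarrow>
     (\<forall>f. integrable m f \<longrightarrow>
        integrable m (L f) \<and>
        (\<forall>g\<in>borel_measurable m. (\<exists>c. AE x in m. cmod (g x) \<le> c) \<longrightarrow>
           (\<integral>x. L f x * g x \<partial>m) = (\<integral>x. f x * g (S x) \<partial>m)))"

definition annealed_operator ::
    "'w measure \<Rightarrow> ('w \<Rightarrow> ('x \<Rightarrow> complex) \<Rightarrow> 'x \<Rightarrow> complex) \<Rightarrow>
     ('x \<Rightarrow> complex) \<Rightarrow> 'x \<Rightarrow> complex" where
  "annealed_operator Pr L f = (\<lambda>x. \<integral>\<omega>. L \<omega> f x \<partial>Pr)"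

definition twisted_operator ::
    "'w measure \<Rightarrow> ('w \<Rightarrow> ('x \<Rightarrow> complex) \<Rightarrow> 'x \<Rightarrow> complex) \<Rightarrow> ('x \<Rightarrow> real) \<Rightarrow> complex \<Rightarrow>
     ('x \<Rightarrow> complex) \<Rightarrow> 'x \<Rightarrow> complex" where
  "twisted_operator Pr L \<phi> z f = annealed_operator Pr L (\<lambda>x. exp (z * of_real (\<phi> x)) * f x)"

definition stationary_measure ::
    "'w measure \<Rightarrow> 'x measure \<Rightarrow> ('w \<Rightarrow> 'x \<Rightarrow> 'x) \<Rightarrow> 'x measure \<Rightarrow> bool" where
  "stationary_measure Pr m T \<mu> \<longleftrightarrow>
     prob_space \<mu> \<and> sets \<mu> = sets m \<and>
     (\<forall>A\<in>sets m. emeasure \<mu> A = (\<integral>\<^sup>+\<omega>. emeasure \<mu> (T \<omega> -` A \<inter> space m) \<partial>Pr))"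

text \<open>
  \<open>L \<omega> f\<close> is a version of the transfer operator of \<open>T \<omega>\<close> applied to \<open>f\<close>. Since it is determined
  only up to an \<open>m\<close>-null set for each \<open>\<omega>\<close>, the integral over \<open>\<omega>\<close> of \<open>L \<omega> f x\<close> at a point \<open>x\<close>
  presupposes that the versions are chosen jointly measurable in \<open>(\<omega>, x)\<close>; the resulting annealed
  operator does not depend, up to null sets, on the choice.
\<close>

locale random_system =
  Omega: prob_space Pr + X: prob_space m
  for Pr :: "'w measure" and m :: "'x measure" +
  fixes T :: "'w \<Rightarrow> 'x \<Rightarrow> 'x"
    and L :: "'w \<Rightarrow> ('x \<Rightarrow> complex) \<Rightarrow> 'x \<Rightarrow> complex"
  assumes T_measurable: "(\<lambda>(\<omega>, x). T \<omega> x) \<in> measurable (Pr \<Otimes>\<^sub>M m) m"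
    and T_nonsingular: "\<And>\<omega>. \<omega> \<in> space Pr \<Longrightarrow> nonsingular_map m (T \<omega>)"
    and L_transfer: "\<And>\<omega>. \<omega> \<in> space Pr \<Longrightarrow> transfer_operator m (T \<omega>) (L \<omega>)"
    and L_measurable:
      "\<And>f. integrable m f \<Longrightarrow> (\<lambda>(\<omega>, x). L \<omega> f x) \<in> borel_measurable (Pr \<Otimes>\<^sub>M m)"

locale annealed_system = random_system Pr m T L
  for Pr :: "'w measure" and m :: "'x measure" and T L +
  fixes B :: "('x \<Rightarrow> complex) set" and nrm :: "('x \<Rightarrow> complex) \<Rightarrow> real"
    and B0 :: "('x \<Rightarrow> complex) set" and nrm0 :: "('x \<Rightarrow> complex) \<Rightarrow> real"
  assumes B_banach: "banach_in_L1 m B nrm"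
    and B_compact: "compactly_embedded_in_L1 m B nrm"
    and B_const: "\<And>c. (\<lambda>x. c) \<in> B"
    and B_lattice: "\<And>f. f \<in> B \<Longrightarrow> (\<lambda>x. of_real (cmod (f x))) \<in> B \<and> (\<lambda>x. cnj (f x)) \<in> B"
    and P_B: "annealed_operator Pr L ` B \<subseteq> B"
    and P_continuous: "\<exists>c. \<forall>f\<in>B. nrm (annealed_operator Pr L f) \<le> c * nrm f"
    and lasota_yorke:
      "\<exists>(N::nat) \<rho> K. 1 \<le> N \<and> \<rho> < 1 \<and> 0 \<le> K \<and>
         (\<forall>f\<in>B. nrm ((annealed_operator Pr L ^^ N) f) \<le> \<rho> * nrm f + K * L1_norm m f)"
    and one_simple_isolated:
      "isolated_eigenvalue B nrm (annealed_operator Pr L) 1"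
      "has_algebraic_multiplicity B nrm (annealed_operator Pr L) 1 1"
    and one_unique:
      "\<And>\<zeta>. op_eigenvalue B nrm (annealed_operator Pr L) \<zeta> \<Longrightarrow> cmod \<zeta> = 1 \<Longrightarrow> \<zeta> = 1"
    and B0_banach: "banach_in_L1 m B0 nrm0"
    and B0_multiplier:
      "\<exists>C>0. \<forall>f\<in>B0. \<forall>g\<in>B. (\<lambda>x. f x * g x) \<in> B \<and> nrm (\<lambda>x. f x * g x) \<le> C * nrm0 f * nrm g"

definition aperiodic ::
    "'w measure \<Rightarrow> ('w \<Rightarrow> ('x \<Rightarrow> complex) \<Rightarrow> 'x \<Rightarrow> complex) \<Rightarrow>
     ('x \<Rightarrow> complex) set \<Rightarrow> (('x \<Rightarrow> complex) \<Rightarrow> real) \<Rightarrow> ('x \<Rightarrow> real) \<Rightarrow> bool" where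
  "aperiodic Pr L B nrm \<phi> \<longleftrightarrow>
     (\<forall>t::real. t \<noteq> 0 \<longrightarrow>
        op_spectral_radius B nrm (twisted_operator Pr L \<phi> (\<i> * of_real t)) < 1)"

end

theory Submission
  imports Defs
begin

text \<open>
  If \<open>\<phi>\<close> is not aperiodic, then for some \<open>t \<noteq> 0\<close> the twisted operator \<open>P\<^sub>i\<^sub>t\<close> has spectral radius
  exactly \<open>1\<close>. Its essential spectral radius being smaller, spectral points close to the unit circle
  are eigenvalues, and a limit of eigenvalues is again in the spectrum; so there is an eigenvalue
  \<open>\<zeta>\<close> with \<open>\<bar>\<zeta>\<bar> = 1\<close> (\<open>unimodular_eigenvalue\<close>). Let \<open>P\<^sub>i\<^sub>t f = \<zeta> f\<close> with \<open>f \<noteq> 0\<close>.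

  Everything else comes from one equality case of the triangle inequality. Let \<open>s\<close> be the complex
  conjugate of \<open>sgn f\<close>, so that \<open>f s = \<bar>f\<bar>\<close>. Testing the eigenvalue equation against \<open>s\<close> and using
  the duality \<open>\<integral> P u \<psi> dm = \<integral>\<integral> u(x) \<psi>(T\<^sub>\<omega> x) dm d\<P>\<close> (\<open>annealed_dual\<close>) gives
  \<open>\<integral> \<bar>f\<bar> dm = \<integral>\<integral> cnj \<zeta> e\<^sup>i\<^sup>t\<^sup>\<phi>\<^sup>(\<^sup>x\<^sup>) f(x) s(T\<^sub>\<omega> x) dm d\<P>\<close>.
  The integrand on the right has modulus at most \<open>\<bar>f(x)\<bar>\<close>, hence it equals \<open>\<bar>f(x)\<bar>\<close> for almost
  every \<open>(\<omega>, x)\<close> (\<open>unimodular_eigenfunction_rigid\<close>). Wherever \<open>f(x) \<noteq> 0\<close>, dividing by \<open>\<bar>f(x)\<bar>\<close>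
  turns this into the claimed relation for \<open>g = sgn f\<close>.

  It remains to see that \<open>f\<close> vanishes almost nowhere and that \<open>g h \<in> B\<close>. Multiplying the same
  pointwise identity by a further test function of \<open>T\<^sub>\<omega> x\<close> shows \<open>P \<bar>f\<bar> = \<bar>f\<bar>\<close>
  (\<open>unimodular_eigenfunction_modulus_fixed\<close>). Stationarity
  of \<open>\<mu>\<close> means \<open>P h = h\<close>, and the eigenvalue \<open>1\<close> is simple, so \<open>\<bar>f\<bar> = c h\<close> with \<open>c \<noteq> 0\<close>
  (\<open>fixed_functions_proportional\<close>). Since \<open>\<mu>\<close> is equivalent to \<open>m\<close>, \<open>h > 0\<close> almost everywhere;
  therefore \<open>f \<noteq> 0\<close> almost everywhere, and \<open>g h = f / c\<close> belongs to \<open>B\<close>.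
\<close>

section \<open>Integration\<close>

text \<open>
  The real part of \<open>w\<close> is at most \<open>v\<close> and has the same integral, so the two agree almost everywhere;
  no room is then left for an imaginary part.
\<close>

lemma AE_eq_of_integral_eq_of_cmod_le:
  fixes w :: "'a \<Rightarrow> complex" and v :: "'a \<Rightarrow> real"
  assumes w: "integrable M w" and v: "integrable M v"
    and le: "AE x in M. cmod (w x) \<le> v x"
    and eq: "(\<integral>x. w x \<partial>M) = of_real (\<integral>x. v x \<partial>M)"
  shows "AE x in M. w x = of_real (v x)"
proof -
  have Re_w: "integrable M (\<lambda>x. Re (w x))" and int_Re: "(\<integral>x. Re (w x) \<partial>M) = Re (\<integral>x. w x \<partial>M)"
    using w by simp_all
  have "(\<integral>x. v x - Re (w x) \<partial>M) = 0"
    using Re_w v int_Re eq by simp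
  moreover have "AE x in M. 0 \<le> v x - Re (w x)"
    using le by eventually_elim (meson complex_Re_le_cmod diff_ge_0_iff_ge order_trans)
  ultimately have "AE x in M. v x - Re (w x) = 0"
    using integral_nonneg_eq_0_iff_AE[of M "\<lambda>x. v x - Re (w x)"] Re_w v by simp
  with le show ?thesis
  proof eventually_elim
    case (elim x)
    then have "(Re (w x))\<^sup>2 + (Im (w x))\<^sup>2 \<le> (Re (w x))\<^sup>2"
      using power_mono[of "cmod (w x)" "v x" 2] by (simp add: cmod_power2)
    then show ?case
      using elim by (simp add: complex_eq_iff)
  qed
qed

lemma integrable_mult_test:
  fixes w :: "'a \<Rightarrow> complex"
  assumes w: "integrable M w" and \<psi>: "\<psi> \<in> borel_measurable M" "\<And>x. cmod (\<psi> x) \<le> 1"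
  shows "integrable M (\<lambda>x. w x * \<psi> x)"
  by (rule Bochner_Integration.integrable_bound[OF w])
    (use w \<psi> in \<open>auto simp: norm_mult intro!: mult_left_le\<close>)

lemma borel_measurable_cnj_sgn:
  fixes u :: "'a \<Rightarrow> complex"
  assumes "u \<in> borel_measurable M"
  shows "(\<lambda>x. cnj (sgn (u x))) \<in> borel_measurable M"
proof -
  have [measurable]: "cnj \<in> borel_measurable borel"
    by (intro borel_measurable_continuous_onI continuous_intros)
  show ?thesis
    using assms by measurable
qed

lemma mult_cnj_sgn: "z * cnj (sgn z) = of_real (cmod z)" for z :: complex
  by (cases "z = 0") (simp_all add: sgn_eq complex_norm_square[symmetric] power2_eq_square)

text \<open>
  Testing \<open>u\<close> against the conjugate of its own sign returns its \<open>L\<^sup>1\<close> norm, so identities between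
  functions known only up to null sets may be checked by duality.
\<close>

lemma AE_zero_of_tests:
  fixes u :: "'a \<Rightarrow> complex"
  assumes u: "integrable M u"
    and tests: "\<And>\<psi>. \<psi> \<in> borel_measurable M \<Longrightarrow> (\<And>x. cmod (\<psi> x) \<le> 1) \<Longrightarrow> (\<integral>x. u x * \<psi> x \<partial>M) = 0"
  shows "AE x in M. u x = 0"
proof -
  have "(\<integral>x. u x * cnj (sgn (u x)) \<partial>M) = 0"
    by (rule tests) (use u in \<open>auto simp: norm_sgn intro!: borel_measurable_cnj_sgn\<close>)
  then have "(\<integral>x. cmod (u x) \<partial>M) = 0"
    by (simp add: mult_cnj_sgn)
  then show ?thesis
    using u integral_nonneg_eq_0_iff_AE[of M "\<lambda>x. cmod (u x)"] by simp
qed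

section \<open>Spaces of integrable functions\<close>

lemma banach_in_L1D:
  assumes "banach_in_L1 m V nrm"
  shows banach_in_L1_integrable: "\<And>f. f \<in> V \<Longrightarrow> integrable m f"
    and banach_in_L1_cong:
      "\<And>f g. f \<in> V \<Longrightarrow> g \<in> borel_measurable m \<Longrightarrow> AE x in m. g x = f x \<Longrightarrow> g \<in> V"
    and banach_in_L1_zero: "(\<lambda>x. 0) \<in> V"
    and banach_in_L1_add: "\<And>f g. f \<in> V \<Longrightarrow> g \<in> V \<Longrightarrow> (\<lambda>x. f x + g x) \<in> V"
    and banach_in_L1_scale: "\<And>c f. f \<in> V \<Longrightarrow> (\<lambda>x. c * f x) \<in> V"
    and banach_in_L1_nonneg: "\<And>f. f \<in> V \<Longrightarrow> 0 \<le> nrm f"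
    and banach_in_L1_null: "\<And>f. f \<in> V \<Longrightarrow> nrm f = 0 \<longleftrightarrow> (AE x in m. f x = 0)"
    and banach_in_L1_norm_scale: "\<And>c f. f \<in> V \<Longrightarrow> nrm (\<lambda>x. c * f x) = cmod c * nrm f"
    and banach_in_L1_triangle:
      "\<And>f g. f \<in> V \<Longrightarrow> g \<in> V \<Longrightarrow> nrm (\<lambda>x. f x + g x) \<le> nrm f + nrm g"
    and banach_in_L1_complete:
      "\<And>u. (\<And>n::nat. u n \<in> V) \<Longrightarrow>
        (\<And>e. e > 0 \<Longrightarrow> \<exists>M. \<forall>i\<ge>M. \<forall>j\<ge>M. nrm (\<lambda>x. u i x - u j x) < e) \<Longrightarrow>
        \<exists>l\<in>V. (\<lambda>n. nrm (\<lambda>x. u n x - l x)) \<longlonglongrightarrow> 0"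
  using assms unfolding banach_in_L1_def complex_subspace_def by blast+

lemma banach_in_L1_diff:
  assumes V: "banach_in_L1 m V nrm" and f: "f \<in> V" and g: "g \<in> V"
  shows "(\<lambda>x. f x - g x) \<in> V"
  using banach_in_L1_add[OF V f banach_in_L1_scale[OF V g, of "-1"]] by simp

lemma banach_in_L1_norm_minus_commute:
  assumes V: "banach_in_L1 m V nrm" and f: "f \<in> V" and g: "g \<in> V"
  shows "nrm (\<lambda>x. f x - g x) = nrm (\<lambda>x. g x - f x)"
  using banach_in_L1_norm_scale[OF V banach_in_L1_diff[OF V f g], of "-1"] by simp

lemma banach_in_L1_sum:
  assumes V: "banach_in_L1 m V nrm" and t: "\<And>k. k \<in> I \<Longrightarrow> t k \<in> V" and "finite I"
  shows "(\<lambda>x. \<Sum>k\<in>I. t k x) \<in> V \<and> nrm (\<lambda>x. \<Sum>k\<in>I. t k x) \<le> (\<Sum>k\<in>I. nrm (t k))"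
  using \<open>finite I\<close> t
proof (induction I rule: finite_induct)
  case empty
  then show ?case
    using banach_in_L1_zero[OF V] banach_in_L1_null[OF V banach_in_L1_zero[OF V]] by simp
next
  case (insert k I)
  then have IH: "(\<lambda>x. \<Sum>k\<in>I. t k x) \<in> V" "nrm (\<lambda>x. \<Sum>k\<in>I. t k x) \<le> (\<Sum>k\<in>I. nrm (t k))"
    and tk: "t k \<in> V" by auto
  show ?case
    using insert.hyps IH banach_in_L1_add[OF V tk IH(1)] banach_in_L1_triangle[OF V tk IH(1)]
    by auto
qed

text \<open>
  Compactness of the embedding contains its continuity: otherwise some sequence in the unit ball of
  \<open>V\<close> has \<open>L\<^sup>1\<close> norms growing to infinity along every subsequence, and none of these converges.
\<close>

lemma L1_norm_le_nrm:
  assumes V: "banach_in_L1 m V nrm" and compact: "compactly_embedded_in_L1 m V nrm"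
  shows "\<exists>K. \<forall>f\<in>V. L1_norm m f \<le> K * nrm f"
proof (rule ccontr)
  assume "\<not> ?thesis"
  then have "\<forall>n::nat. \<exists>f\<in>V. L1_norm m f > real n * nrm f"
    by (metis not_le)
  then obtain f where f: "\<And>n::nat. f n \<in> V" "\<And>n. L1_norm m (f n) > real n * nrm (f n)"
    by metis
  have pos: "nrm (f n) > 0" for n
  proof (rule ccontr)
    assume "\<not> nrm (f n) > 0"
    then have z: "nrm (f n) = 0"
      using banach_in_L1_nonneg[OF V f(1)[of n]] by simp
    then have ae: "AE x in m. cmod (f n x) = 0"
      using banach_in_L1_null[OF V f(1)[of n]] by simp
    have "L1_norm m (f n) = 0"
      unfolding L1_norm_def by (rule integral_eq_zero_AE[OF ae])
    then show False
      using f(2)[of n] z by simp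
  qed
  define u where "u n = (\<lambda>x. of_real (inverse (nrm (f n))) * f n x)" for n
  have u: "u n \<in> V" "nrm (u n) = 1" for n
    using f(1)[of n] pos[of n] banach_in_L1_norm_scale[OF V f(1)[of n]]
    by (auto simp: u_def norm_inverse intro!: banach_in_L1_scale[OF V])
  have large: "L1_norm m (u n) > real n" for n
  proof -
    have "nrm (f n) * L1_norm m (u n) = L1_norm m (f n)"
      using pos[of n] by (simp add: u_def L1_norm_def norm_mult norm_inverse)
    then have "nrm (f n) * real n < nrm (f n) * L1_norm m (u n)"
      using f(2)[of n] by (simp add: mult.commute)
    then show ?thesis
      using pos[of n] by simp
  qed
  obtain r l where r: "strict_mono r" and l: "integrable m l"
    and lim: "(\<lambda>n. L1_norm m (\<lambda>x. u (r n) x - l x)) \<longlonglongrightarrow> 0"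
    using compact u unfolding compactly_embedded_in_L1_def by (metis order_refl)
  have "\<forall>\<^sub>F n in sequentially. L1_norm m (\<lambda>x. u (r n) x - l x) < 1"
    using order_tendstoD(2)[OF lim, of 1] by simp
  moreover have "\<forall>\<^sub>F n in sequentially. L1_norm m l + 1 < real n"
    by (rule eventually_at_top_linorderI[of "nat \<lceil>L1_norm m l + 2\<rceil>"]) linarith
  ultimately have "\<forall>\<^sub>F n::nat in sequentially. False"
  proof eventually_elim
    case (elim n)
    have ui: "integrable m (u (r n))"
      using banach_in_L1_integrable[OF V u(1)] .
    have "L1_norm m (u (r n)) \<le> (\<integral>x. cmod (u (r n) x - l x) + cmod (l x) \<partial>m)"
      unfolding L1_norm_def
      by (rule integral_mono) (use ui l norm_triangle_sub in \<open>auto simp: add.commute\<close>)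
    also have "\<dots> = L1_norm m (\<lambda>x. u (r n) x - l x) + L1_norm m l"
      unfolding L1_norm_def by (rule Bochner_Integration.integral_add) (use ui l in auto)
    finally have "L1_norm m (u (r n)) < real n"
      using elim by linarith
    then show ?case
      using large[of "r n"] seq_suble[OF r, of n] by linarith
  qed
  then show False
    by simp
qed

text \<open>
  The exponential series of the multiplication operator by \<open>q\<close> converges in \<open>V\<close>, and it converges
  pointwise to \<open>exp (q x) * f x\<close>. The two limits agree almost everywhere because convergence in \<open>V\<close>
  implies convergence in \<open>L\<^sup>1\<close>, hence pointwise convergence along a subsequence.
\<close>

lemma exp_multiplier:
  assumes V: "banach_in_L1 m V nrm" and compact: "compactly_embedded_in_L1 m V nrm"
    and q: "q \<in> borel_measurable m"
    and mult: "\<And>f. f \<in> V \<Longrightarrow> (\<lambda>x. q x * f x) \<in> V \<and> nrm (\<lambda>x. q x * f x) \<le> K * nrm f"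
    and K: "0 \<le> K" and f: "f \<in> V"
  shows "(\<lambda>x. exp (q x) * f x) \<in> V"
proof -
  define t where "t k = (\<lambda>x. inverse (fact k) * q x ^ k * f x)" for k :: nat
  define b where "b k = inverse (fact k) * K ^ k * nrm f" for k :: nat
  define u where "u n = (\<lambda>x. \<Sum>k<n. t k x)" for n
  have t: "t k \<in> V \<and> nrm (t k) \<le> b k" for k
  proof (induction k)
    case 0
    then show ?case using f by (simp add: t_def b_def)
  next
    case (Suc k)
    let ?s = "\<lambda>x. q x * t k x" and ?c = "inverse (of_nat (Suc k)) :: complex"
    have eq: "t (Suc k) = (\<lambda>x. ?c * ?s x)"
      by (simp add: t_def fun_eq_iff del: of_nat_Suc)
    have s: "?s \<in> V" "nrm ?s \<le> K * nrm (t k)"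
      using mult Suc by auto
    have "nrm (t (Suc k)) = inverse (real (Suc k)) * nrm ?s"
      unfolding eq using banach_in_L1_norm_scale[OF V s(1), of ?c]
      by (simp add: norm_inverse del: of_nat_Suc)
    also have "\<dots> \<le> inverse (real (Suc k)) * (K * b k)"
      using s(2) Suc K by (intro mult_left_mono) (auto intro: order_trans mult_left_mono)
    also have "\<dots> = b (Suc k)"
      by (simp add: b_def del: of_nat_Suc)
    finally show ?case
      using banach_in_L1_scale[OF V s(1), of ?c] unfolding eq by simp
  qed
  have b: "summable b"
    unfolding b_def by (intro summable_mult2 summable_exp)
  have u: "u n \<in> V" for n
    unfolding u_def using banach_in_L1_sum[OF V, of "{..<n}" t] t by auto
  have block: "nrm (\<lambda>x. u i x - u j x) \<le> norm (sum b {j..<i})" if "j \<le> i" for i j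
  proof -
    have "u i x - u j x = (\<Sum>k=j..<i. t k x)" for x
      using that sum_diff[of "{..<i}" "{..<j}" "\<lambda>k. t k x"]
      by (simp add: u_def atLeastLessThan_eq_atLeastAtMost_diff lessThan_minus_lessThan)
    then have "nrm (\<lambda>x. u i x - u j x) \<le> (\<Sum>k=j..<i. nrm (t k))"
      using banach_in_L1_sum[OF V, of "{j..<i}" t] t by auto
    also have "\<dots> \<le> sum b {j..<i}"
      using t by (intro sum_mono) auto
    finally show ?thesis
      by simp
  qed
  have "\<exists>l\<in>V. (\<lambda>n. nrm (\<lambda>x. u n x - l x)) \<longlonglongrightarrow> 0"
  proof (rule banach_in_L1_complete[OF V u])
    fix e :: real assume "e > 0"
    then obtain N where N: "\<And>j i. j \<ge> N \<Longrightarrow> norm (sum b {j..<i}) < e"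
      using b unfolding summable_Cauchy by meson
    have "nrm (\<lambda>x. u i x - u j x) < e" if "i \<ge> N" "j \<ge> N" for i j
    proof (cases "j \<le> i")
      case True
      then show ?thesis using block[of j i] N[of j i] that by linarith
    next
      case False
      then show ?thesis
        using block[of i j] N[of i j] that banach_in_L1_norm_minus_commute[OF V u[of i] u[of j]]
        by linarith
    qed
    then show "\<exists>M. \<forall>i\<ge>M. \<forall>j\<ge>M. nrm (\<lambda>x. u i x - u j x) < e"
      by blast
  qed
  then obtain l where l: "l \<in> V" and lim: "(\<lambda>n. nrm (\<lambda>x. u n x - l x)) \<longlonglongrightarrow> 0"
    by blast
  obtain K' where K': "\<And>g. g \<in> V \<Longrightarrow> L1_norm m g \<le> K' * nrm g"
    using L1_norm_le_nrm[OF V compact] by blast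
  have "(\<lambda>n. L1_norm m (\<lambda>x. u n x - l x)) \<longlonglongrightarrow> 0"
  proof (rule tendsto_sandwich)
    show "\<forall>\<^sub>F n in sequentially. 0 \<le> L1_norm m (\<lambda>x. u n x - l x)"
      by (simp add: L1_norm_def)
    show "\<forall>\<^sub>F n in sequentially. L1_norm m (\<lambda>x. u n x - l x) \<le> K' * nrm (\<lambda>x. u n x - l x)"
      using K' banach_in_L1_diff[OF V u l] by simp
    show "(\<lambda>n. K' * nrm (\<lambda>x. u n x - l x)) \<longlonglongrightarrow> 0"
      using tendsto_mult_right_zero[OF lim] .
  qed simp
  then obtain r where r: "strict_mono r" and ae: "AE x in m. (\<lambda>n. u (r n) x - l x) \<longlonglongrightarrow> 0"
    using tendsto_L1_AE_subseq[of m "\<lambda>n x. u n x - l x"]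
      banach_in_L1_integrable[OF V banach_in_L1_diff[OF V u l]]
    unfolding L1_norm_def by blast
  have pw: "(\<lambda>n. u n x) \<longlonglongrightarrow> exp (q x) * f x" for x
  proof -
    have "(\<lambda>k. q x ^ k /\<^sub>R fact k) sums exp (q x)"
      by (rule exp_converges)
    then have "(\<lambda>k. (q x ^ k /\<^sub>R fact k) * f x) sums (exp (q x) * f x)"
      by (rule sums_mult2)
    moreover have "(\<lambda>k. (q x ^ k /\<^sub>R fact k) * f x) = (\<lambda>k. t k x)"
      by (simp add: t_def scaleR_conv_of_real fun_eq_iff)
    ultimately show ?thesis
      unfolding sums_def u_def by metis
  qed
  have "AE x in m. exp (q x) * f x = l x"
    using ae
  proof eventually_elim
    case (elim x)
    have "(\<lambda>n. u (r n) x - l x) \<longlonglongrightarrow> exp (q x) * f x - l x"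
      using LIMSEQ_subseq_LIMSEQ[OF pw r] by (intro tendsto_diff) (auto simp: o_def)
    then show ?case
      using LIMSEQ_unique[OF elim] by fastforce
  qed
  moreover have "(\<lambda>x. exp (q x) * f x) \<in> borel_measurable m"
    using q borel_measurable_integrable[OF banach_in_L1_integrable[OF V f]] by measurable
  ultimately show ?thesis
    using banach_in_L1_cong[OF V l] by blast
qed

section \<open>Eigenvalues on the unit circle\<close>

lemma spectrum_point_is_eigenvalue:
  assumes "op_essential_spectral_radius V nrm A < ennreal (cmod \<zeta>)" and "\<zeta> \<in> op_spectrum V nrm A"
  shows "op_eigenvalue V nrm A \<zeta>"
proof -
  have "\<zeta> \<notin> op_essential_spectrum V nrm A"
    using assms(1) SUP_upper[of \<zeta> "op_essential_spectrum V nrm A" "\<lambda>\<zeta>. ennreal (cmod \<zeta>)"]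
    unfolding op_essential_spectral_radius_def by fastforce
  with assms(2) show ?thesis
    unfolding op_essential_spectrum_def isolated_eigenvalue_def by blast
qed

text \<open>
  For an eigenfunction \<open>f\<close> of \<open>z n\<close> one has \<open>(\<zeta> - A) f = (\<zeta> - z n) f\<close>, which violates any lower bound
  for \<open>\<zeta> - A\<close> once \<open>z n\<close> is close to \<open>\<zeta>\<close>.
\<close>

lemma limit_of_eigenvalues_in_spectrum:
  assumes V: "banach_in_L1 m V nrm" and A: "\<And>f. f \<in> V \<Longrightarrow> A f \<in> V"
    and ev: "\<And>n::nat. op_eigenvalue V nrm A (z n)" and lim: "z \<longlonglongrightarrow> \<zeta>"
  shows "\<zeta> \<in> op_spectrum V nrm A"
proof (rule ccontr)
  assume "\<zeta> \<notin> op_spectrum V nrm A"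
  then obtain c where c: "\<And>f. f \<in> V \<Longrightarrow> nrm f \<le> c * nrm (op_shift A \<zeta> f)"
    unfolding op_spectrum_def resolvent_set_def by blast
  have bound: "1 \<le> \<bar>c\<bar> * cmod (\<zeta> - z n)" for n
  proof -
    obtain f where f: "f \<in> V" "nrm f \<noteq> 0" "nrm (op_shift A (z n) f) = 0"
      using ev unfolding op_eigenvalue_def by blast
    have shift: "op_shift A (z n) f \<in> V"
      unfolding op_shift_def
      by (rule banach_in_L1_diff[OF V banach_in_L1_scale[OF V f(1)] A[OF f(1)]])
    have "op_shift A \<zeta> f = (\<lambda>x. (\<zeta> - z n) * f x + op_shift A (z n) f x)"
      by (simp add: op_shift_def fun_eq_iff algebra_simps)
    then have "nrm (op_shift A \<zeta> f) \<le> cmod (\<zeta> - z n) * nrm f"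
      using banach_in_L1_triangle[OF V banach_in_L1_scale[OF V f(1)] shift]
        banach_in_L1_norm_scale[OF V f(1)] f(3) by (metis add_0_right)
    moreover have "nrm f \<le> \<bar>c\<bar> * nrm (op_shift A \<zeta> f)"
    proof -
      have "op_shift A \<zeta> f \<in> V"
        unfolding op_shift_def
        by (rule banach_in_L1_diff[OF V banach_in_L1_scale[OF V f(1)] A[OF f(1)]])
      then have "c * nrm (op_shift A \<zeta> f) \<le> \<bar>c\<bar> * nrm (op_shift A \<zeta> f)"
        by (intro mult_right_mono banach_in_L1_nonneg[OF V]) auto
      with c[OF f(1)] show ?thesis by linarith
    qed
    ultimately have "nrm f \<le> \<bar>c\<bar> * (cmod (\<zeta> - z n) * nrm f)"
      by (meson abs_ge_zero mult_left_mono order_trans)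
    then show ?thesis
      using f(2) banach_in_L1_nonneg[OF V f(1)]
      by (metis less_eq_real_def mult.assoc mult.left_neutral mult_le_cancel_right not_le)
  qed
  have "(\<lambda>n. \<bar>c\<bar> * cmod (\<zeta> - z n)) \<longlonglongrightarrow> \<bar>c\<bar> * cmod (\<zeta> - \<zeta>)"
    by (intro tendsto_intros lim)
  then have "1 \<le> \<bar>c\<bar> * cmod (\<zeta> - \<zeta>)"
    by (rule LIMSEQ_le_const) (use bound in auto)
  then show False
    by simp
qed

text \<open>
  The supremum defining the spectral radius is attained: choose spectral points with modulus tending
  to \<open>1\<close> and larger than the essential spectral radius. They are eigenvalues, so any accumulation
  point is in the spectrum, lies on the unit circle, and is an eigenvalue for the same reason.
\<close>

lemma unimodular_eigenvalue:
  assumes V: "banach_in_L1 m V nrm" and A: "\<And>f. f \<in> V \<Longrightarrow> A f \<in> V"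
    and radius: "op_spectral_radius V nrm A = 1"
    and ess: "op_essential_spectral_radius V nrm A < 1"
  shows "\<exists>\<zeta>. cmod \<zeta> = 1 \<and> op_eigenvalue V nrm A \<zeta>"
proof -
  let ?S = "op_spectrum V nrm A" and ?e = "op_essential_spectral_radius V nrm A"
  have le1: "cmod \<zeta> \<le> 1" if "\<zeta> \<in> ?S" for \<zeta>
    using SUP_upper[OF that, of "\<lambda>\<zeta>. ennreal (cmod \<zeta>)"] radius
    unfolding op_spectral_radius_def by (simp add: ennreal_le_1)
  have "\<exists>\<zeta>\<in>?S. max ?e (ennreal (1 - inverse (real (Suc n)))) < ennreal (cmod \<zeta>)" for n
  proof -
    have "ennreal (1 - inverse (real (Suc n))) < ennreal 1"
      by (rule ennreal_lessI) (auto simp del: of_nat_Suc)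
    then have "max ?e (ennreal (1 - inverse (real (Suc n)))) < (SUP \<zeta>\<in>?S. ennreal (cmod \<zeta>))"
      using ess radius unfolding op_spectral_radius_def by simp
    then show ?thesis
      by (simp only: less_SUP_iff)
  qed
  then obtain z where z: "\<And>n. z n \<in> ?S" "\<And>n. ?e < ennreal (cmod (z n))"
    "\<And>n. ennreal (1 - inverse (real (Suc n))) < ennreal (cmod (z n))"
    by (metis max_less_iff_conj)
  have ge: "1 - inverse (real (Suc n)) \<le> cmod (z n)" for n
    using z(3)[of n] ennreal_leI[of "cmod (z n)" "1 - inverse (real (Suc n))"]
    by (metis linear linorder_not_less)
  have ev: "op_eigenvalue V nrm A (z n)" for n
    using spectrum_point_is_eigenvalue z by blast
  have "bounded (range z)"
    using le1 z(1) by (auto simp: bounded_iff)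
  then obtain \<zeta> r where r: "strict_mono (r :: nat \<Rightarrow> nat)" and lim: "(z \<circ> r) \<longlonglongrightarrow> \<zeta>"
    using bounded_imp_convergent_subsequence by blast
  have "\<zeta> \<in> ?S"
    by (rule limit_of_eigenvalues_in_spectrum[OF V A _ lim]) (use ev in auto)
  have "(\<lambda>n. cmod (z n)) \<longlonglongrightarrow> 1"
  proof (rule tendsto_sandwich)
    have "(\<lambda>n. 1 - inverse (real (Suc n))) \<longlonglongrightarrow> 1 - 0"
      by (intro tendsto_intros LIMSEQ_inverse_real_of_nat)
    then show "(\<lambda>n. 1 - inverse (real (Suc n))) \<longlonglongrightarrow> 1" by simp
  qed (use ge le1 z(1) in auto)
  then have "cmod \<zeta> = 1"
    using LIMSEQ_unique[OF tendsto_norm[OF lim]] LIMSEQ_subseq_LIMSEQ[OF _ r]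
    by (fastforce simp: o_def)
  moreover have "op_eigenvalue V nrm A \<zeta>"
    by (rule spectrum_point_is_eigenvalue[OF _ \<open>\<zeta> \<in> ?S\<close>]) (use ess \<open>cmod \<zeta> = 1\<close> in simp)
  ultimately show ?thesis
    by blast
qed

section \<open>Duality for the annealed operator\<close>

context random_system
begin

sublocale pair_sigma_finite Pr m ..

lemma T_pair [measurable]: "(\<lambda>p. T (fst p) (snd p)) \<in> measurable (Pr \<Otimes>\<^sub>M m) m"
  using T_measurable by (simp add: case_prod_beta')

lemma L_dual:
  assumes "\<omega> \<in> space Pr" and "integrable m f"
  shows "integrable m (L \<omega> f)"
    and "\<psi> \<in> borel_measurable m \<Longrightarrow> (\<And>x. cmod (\<psi> x) \<le> 1) \<Longrightarrow>
      (\<integral>x. L \<omega> f x * \<psi> x \<partial>m) = (\<integral>x. f x * \<psi> (T \<omega> x) \<partial>m)"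
  using L_transfer[OF assms(1)] assms(2) unfolding transfer_operator_def by (blast intro: AE_I2)+

lemma T_section: "\<omega> \<in> space Pr \<Longrightarrow> T \<omega> \<in> measurable m m"
  using T_nonsingular unfolding nonsingular_map_def by blast

text \<open>
  Needed for Fubini: it bounds the \<open>L\<^sup>1\<close> norms of \<open>L \<omega> f\<close> uniformly in \<open>\<omega>\<close>, so that \<open>(\<omega>, x) \<mapsto> L \<omega> f x\<close>
  is integrable on the product.
\<close>

lemma L_contracts_L1:
  assumes w: "\<omega> \<in> space Pr" and f: "integrable m f"
  shows "(\<integral>x. cmod (L \<omega> f x) \<partial>m) \<le> (\<integral>x. cmod (f x) \<partial>m)"
proof -
  let ?\<psi> = "\<lambda>x. cnj (sgn (L \<omega> f x))"
  have \<psi>: "?\<psi> \<in> borel_measurable m" "cmod (?\<psi> x) \<le> 1" for x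
    using L_dual(1)[OF w f] by (auto simp: norm_sgn intro!: borel_measurable_cnj_sgn)
  note [measurable] = \<psi>(1) T_section[OF w] borel_measurable_integrable[OF f]
  have "complex_of_real (\<integral>x. cmod (L \<omega> f x) \<partial>m) = (\<integral>x. L \<omega> f x * ?\<psi> x \<partial>m)"
    by (simp add: mult_cnj_sgn)
  also have "\<dots> = (\<integral>x. f x * ?\<psi> (T \<omega> x) \<partial>m)"
    by (rule L_dual(2)[OF w f \<psi>])
  finally have eq: "complex_of_real (\<integral>x. cmod (L \<omega> f x) \<partial>m) = (\<integral>x. f x * ?\<psi> (T \<omega> x) \<partial>m)" .
  have "(\<integral>x. cmod (L \<omega> f x) \<partial>m) = cmod (complex_of_real (\<integral>x. cmod (L \<omega> f x) \<partial>m))"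
    by simp
  also have "\<dots> \<le> (\<integral>x. cmod (f x * ?\<psi> (T \<omega> x)) \<partial>m)"
    unfolding eq by (rule integral_norm_bound)
  also have "\<dots> \<le> (\<integral>x. cmod (f x) \<partial>m)"
  proof (rule integral_mono)
    have le: "cmod (f x * ?\<psi> (T \<omega> x)) \<le> cmod (f x)" for x
      using mult_left_mono[OF \<psi>(2)[of "T \<omega> x"], of "cmod (f x)"] by (simp add: norm_mult)
    then show "cmod (f x * ?\<psi> (T \<omega> x)) \<le> cmod (f x)" for x .
    show "integrable m (\<lambda>x. cmod (f x * ?\<psi> (T \<omega> x)))"
      by (rule Bochner_Integration.integrable_bound[OF f]) (use le in auto)
  qed (use f in auto)
  finally show ?thesis .
qed

lemma L_integrable_pair:
  assumes f: "integrable m f"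
  shows "integrable (Pr \<Otimes>\<^sub>M m) (\<lambda>(\<omega>, x). L \<omega> f x)"
proof (rule Fubini_integrable)
  note [measurable] = L_measurable[OF f]
  show "(\<lambda>(\<omega>, x). L \<omega> f x) \<in> borel_measurable (Pr \<Otimes>\<^sub>M m)"
    by measurable
  have "(\<lambda>\<omega>. \<integral>x. norm (case (\<omega>, x) of (\<omega>, x) \<Rightarrow> L \<omega> f x) \<partial>m) \<in> borel_measurable Pr"
    by measurable
  then show "integrable Pr (\<lambda>\<omega>. \<integral>x. norm (case (\<omega>, x) of (\<omega>, x) \<Rightarrow> L \<omega> f x) \<partial>m)"
    by (rule Omega.integrable_const_bound[where B = "\<integral>x. cmod (f x) \<partial>m", rotated])
      (use L_contracts_L1[OF _ f] in \<open>auto intro!: AE_I2\<close>)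
qed (use L_dual(1)[OF _ f] in \<open>auto intro!: AE_I2\<close>)

lemma integrable_pair_snd:
  fixes f :: "'x \<Rightarrow> complex"
  assumes f: "integrable m f"
  shows "integrable (Pr \<Otimes>\<^sub>M m) (\<lambda>p. f (snd p))"
proof (rule Fubini_integrable)
  show "(\<lambda>p. f (snd p)) \<in> borel_measurable (Pr \<Otimes>\<^sub>M m)"
    using borel_measurable_integrable[OF f] by measurable
qed (use f in auto)

lemma integrable_pair_test:
  fixes f :: "'x \<Rightarrow> complex"
  assumes f: "integrable m f" and \<psi>: "\<psi> \<in> borel_measurable m" "\<And>x. cmod (\<psi> x) \<le> 1"
  shows "integrable (Pr \<Otimes>\<^sub>M m) (\<lambda>p. f (snd p) * \<psi> (T (fst p) (snd p)))"
  by (rule integrable_mult_test[OF integrable_pair_snd[OF f]])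
    (use \<psi> measurable_compose[OF T_pair \<psi>(1)] in auto)

lemma annealed_integrable:
  assumes "integrable m f"
  shows "integrable m (annealed_operator Pr L f)"
  unfolding annealed_operator_def using integrable_snd[OF L_integrable_pair[OF assms]] by simp

lemma annealed_dual:
  assumes f: "integrable m f" and \<psi>: "\<psi> \<in> borel_measurable m" "\<And>x. cmod (\<psi> x) \<le> 1"
  shows "(\<integral>x. annealed_operator Pr L f x * \<psi> x \<partial>m)
    = (\<integral>p. f (snd p) * \<psi> (T (fst p) (snd p)) \<partial>(Pr \<Otimes>\<^sub>M m))"
proof -
  note [measurable] = L_measurable[OF f] \<psi>(1)
  have int: "integrable (Pr \<Otimes>\<^sub>M m) (\<lambda>(\<omega>, x). L \<omega> f x * \<psi> x)"
  proof (rule Bochner_Integration.integrable_bound[OF L_integrable_pair[OF f]])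
    show "(\<lambda>(\<omega>, x). L \<omega> f x * \<psi> x) \<in> borel_measurable (Pr \<Otimes>\<^sub>M m)"
      by measurable
    show "AE p in Pr \<Otimes>\<^sub>M m. norm (case p of (\<omega>, x) \<Rightarrow> L \<omega> f x * \<psi> x)
        \<le> norm (case p of (\<omega>, x) \<Rightarrow> L \<omega> f x)"
      using \<psi>(2) by (auto simp: norm_mult intro!: AE_I2 mult_left_le)
  qed
  have "(\<integral>x. annealed_operator Pr L f x * \<psi> x \<partial>m) = (\<integral>x. (\<integral>\<omega>. L \<omega> f x * \<psi> x \<partial>Pr) \<partial>m)"
    by (simp add: annealed_operator_def)
  also have "\<dots> = (\<integral>\<omega>. (\<integral>x. L \<omega> f x * \<psi> x \<partial>m) \<partial>Pr)"
    by (rule Fubini_integral[OF int])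
  also have "\<dots> = (\<integral>\<omega>. (\<integral>x. f x * \<psi> (T \<omega> x) \<partial>m) \<partial>Pr)"
    by (rule Bochner_Integration.integral_cong[OF refl], rule L_dual(2)[OF _ f \<psi>])
  also have "\<dots> = (\<integral>p. f (snd p) * \<psi> (T (fst p) (snd p)) \<partial>(Pr \<Otimes>\<^sub>M m))"
    using integral_fst'[OF integrable_pair_test[OF f \<psi>]] by simp
  finally show ?thesis .
qed

text \<open>
  The duality determines the annealed operator up to null sets. All its algebraic properties are
  derived from this criterion: for a single \<open>\<omega>\<close>, even additivity of \<open>L \<omega>\<close> holds only off a null set
  depending on \<open>\<omega>\<close>.
\<close>

lemma annealed_eqI:
  assumes u: "integrable m u" and f: "integrable m f"
    and dual: "\<And>\<psi>. \<psi> \<in> borel_measurable m \<Longrightarrow> (\<And>x. cmod (\<psi> x) \<le> 1) \<Longrightarrow>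
      (\<integral>x. u x * \<psi> x \<partial>m) = (\<integral>p. f (snd p) * \<psi> (T (fst p) (snd p)) \<partial>(Pr \<Otimes>\<^sub>M m))"
  shows "AE x in m. annealed_operator Pr L f x = u x"
proof -
  let ?A = "annealed_operator Pr L f"
  have "AE x in m. ?A x - u x = 0"
  proof (rule AE_zero_of_tests)
    show "integrable m (\<lambda>x. ?A x - u x)"
      using annealed_integrable[OF f] u by simp
    fix \<psi> :: "'x \<Rightarrow> complex" assume \<psi>: "\<psi> \<in> borel_measurable m" "\<And>x. cmod (\<psi> x) \<le> 1"
    have "(\<integral>x. (?A x - u x) * \<psi> x \<partial>m) = (\<integral>x. ?A x * \<psi> x \<partial>m) - (\<integral>x. u x * \<psi> x \<partial>m)"
      using integrable_mult_test[OF annealed_integrable[OF f] \<psi>] integrable_mult_test[OF u \<psi>]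
      by (simp add: left_diff_distrib)
    then show "(\<integral>x. (?A x - u x) * \<psi> x \<partial>m) = 0"
      using annealed_dual[OF f \<psi>] dual[OF \<psi>] by simp
  qed
  then show ?thesis
    by simp
qed

lemma AE_pair_snd:
  assumes [measurable]: "Measurable.pred m Q" and "AE x in m. Q x"
  shows "AE p in Pr \<Otimes>\<^sub>M m. Q (snd p)"
  by (rule AE_pair_measure) (use assms in auto)

lemma annealed_cong:
  assumes f: "integrable m f" and g: "integrable m g" and eq: "AE x in m. f x = g x"
  shows "AE x in m. annealed_operator Pr L f x = annealed_operator Pr L g x"
proof (rule annealed_eqI[OF annealed_integrable[OF g] f])
  fix \<psi> :: "'x \<Rightarrow> complex" assume \<psi>: "\<psi> \<in> borel_measurable m" "\<And>x. cmod (\<psi> x) \<le> 1"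
  note [measurable] = borel_measurable_integrable[OF f] borel_measurable_integrable[OF g] \<psi>(1)
  have "AE p in Pr \<Otimes>\<^sub>M m. f (snd p) = g (snd p)"
    by (rule AE_pair_snd[OF _ eq]) measurable
  then have "(\<integral>p. g (snd p) * \<psi> (T (fst p) (snd p)) \<partial>(Pr \<Otimes>\<^sub>M m))
      = (\<integral>p. f (snd p) * \<psi> (T (fst p) (snd p)) \<partial>(Pr \<Otimes>\<^sub>M m))"
    by (intro integral_cong_AE) auto
  then show "(\<integral>x. annealed_operator Pr L g x * \<psi> x \<partial>m)
      = (\<integral>p. f (snd p) * \<psi> (T (fst p) (snd p)) \<partial>(Pr \<Otimes>\<^sub>M m))"
    using annealed_dual[OF g \<psi>] by simp
qed

lemma annealed_add:
  assumes f: "integrable m f" and g: "integrable m g"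
  shows "AE x in m. annealed_operator Pr L (\<lambda>x. f x + g x) x
    = annealed_operator Pr L f x + annealed_operator Pr L g x"
proof (rule annealed_eqI)
  fix \<psi> :: "'x \<Rightarrow> complex" assume \<psi>: "\<psi> \<in> borel_measurable m" "\<And>x. cmod (\<psi> x) \<le> 1"
  show "(\<integral>x. (annealed_operator Pr L f x + annealed_operator Pr L g x) * \<psi> x \<partial>m)
    = (\<integral>p. (f (snd p) + g (snd p)) * \<psi> (T (fst p) (snd p)) \<partial>(Pr \<Otimes>\<^sub>M m))"
    using integrable_mult_test[OF annealed_integrable[OF f] \<psi>]
      integrable_mult_test[OF annealed_integrable[OF g] \<psi>]
      annealed_dual[OF f \<psi>] annealed_dual[OF g \<psi>]
      integrable_pair_test[OF f \<psi>] integrable_pair_test[OF g \<psi>]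
    by (simp add: distrib_right)
qed (use f g annealed_integrable in auto)

text \<open>
  Stationarity says that \<open>(\<omega>, x) \<mapsto> T \<omega> x\<close> maps the product measure of \<open>Pr\<close> and \<open>\<mu>\<close> to \<open>\<mu>\<close>.
  Integrating a test function against this identity and writing \<open>d\<mu> = h dm\<close> gives the duality that
  characterizes the image of \<open>h\<close>.
\<close>

lemma stationary_density_fixed:
  assumes stat: "stationary_measure Pr m T \<mu>" and \<mu>: "\<mu> = density m (\<lambda>x. ennreal (h x))"
    and h: "integrable m (\<lambda>x. complex_of_real (h x))" "h \<in> borel_measurable m"
    and nonneg: "AE x in m. 0 \<le> h x"
  shows "AE x in m. annealed_operator Pr L (\<lambda>x. complex_of_real (h x)) x = complex_of_real (h x)"
proof (rule annealed_eqI[OF h(1) h(1)])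
  fix \<psi> :: "'x \<Rightarrow> complex" assume \<psi>: "\<psi> \<in> borel_measurable m" "\<And>x. cmod (\<psi> x) \<le> 1"
  note [measurable] = \<psi>(1) h(2)
  interpret \<mu>: prob_space \<mu>
    using stat unfolding stationary_measure_def by blast
  have sets[measurable_cong]: "sets \<mu> = sets m" and space: "space \<mu> = space m"
    unfolding \<mu> by simp_all
  interpret P\<mu>: pair_prob_space Pr \<mu> ..
  let ?T = "\<lambda>p. T (fst p) (snd p)"
  have [measurable]: "?T \<in> measurable (Pr \<Otimes>\<^sub>M \<mu>) m"
    using T_pair by (simp cong: measurable_cong_sets add: sets_pair_measure_cong[OF refl sets])
  have "distr (Pr \<Otimes>\<^sub>M \<mu>) m ?T = \<mu>"
  proof (rule measure_eqI)
    fix A assume "A \<in> sets (distr (Pr \<Otimes>\<^sub>M \<mu>) m ?T)"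
    then have A[measurable]: "A \<in> sets m" by simp
    have "emeasure (distr (Pr \<Otimes>\<^sub>M \<mu>) m ?T) A = emeasure (Pr \<Otimes>\<^sub>M \<mu>) (?T -` A \<inter> space (Pr \<Otimes>\<^sub>M \<mu>))"
      by (rule emeasure_distr) measurable
    also have "\<dots> = (\<integral>\<^sup>+\<omega>. emeasure \<mu> (Pair \<omega> -` (?T -` A \<inter> space (Pr \<Otimes>\<^sub>M \<mu>))) \<partial>Pr)"
      by (rule \<mu>.emeasure_pair_measure_alt) measurable
    also have "\<dots> = (\<integral>\<^sup>+\<omega>. emeasure \<mu> (T \<omega> -` A \<inter> space m) \<partial>Pr)"
      by (intro nn_integral_cong arg_cong2[where f = emeasure] refl)
        (auto simp: space_pair_measure space)
    also have "\<dots> = emeasure \<mu> A"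
      using stat A unfolding stationary_measure_def by simp
    finally show "emeasure (distr (Pr \<Otimes>\<^sub>M \<mu>) m ?T) A = emeasure \<mu> A" .
  qed (simp add: sets)
  then have "(\<integral>x. \<psi> x \<partial>\<mu>) = (\<integral>x. \<psi> x \<partial>distr (Pr \<Otimes>\<^sub>M \<mu>) m ?T)"
    by simp
  also have "\<dots> = (\<integral>p. \<psi> (?T p) \<partial>(Pr \<Otimes>\<^sub>M \<mu>))"
    by (rule integral_distr) measurable
  also have "\<dots> = (\<integral>\<omega>. (\<integral>x. \<psi> (T \<omega> x) \<partial>\<mu>) \<partial>Pr)"
  proof -
    have "integrable (Pr \<Otimes>\<^sub>M \<mu>) (\<lambda>p. \<psi> (?T p))"
      by (rule P\<mu>.P.integrable_const_bound[where B = 1]) (use \<psi>(2) in auto)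
    from P\<mu>.integral_fst'[OF this] show ?thesis by simp
  qed
  also have "\<dots> = (\<integral>\<omega>. (\<integral>x. of_real (h x) * \<psi> (T \<omega> x) \<partial>m) \<partial>Pr)"
  proof (rule Bochner_Integration.integral_cong[OF refl])
    fix \<omega> assume "\<omega> \<in> space Pr"
    from T_section[OF this] have [measurable]: "T \<omega> \<in> measurable m m" .
    show "(\<integral>x. \<psi> (T \<omega> x) \<partial>\<mu>) = (\<integral>x. of_real (h x) * \<psi> (T \<omega> x) \<partial>m)"
      unfolding \<mu> by (subst integral_density) (use nonneg in \<open>auto simp: scaleR_conv_of_real\<close>)
  qed
  also have "\<dots> = (\<integral>p. of_real (h (snd p)) * \<psi> (?T p) \<partial>(Pr \<Otimes>\<^sub>M m))"
    using integral_fst'[OF integrable_pair_test[OF h(1) \<psi>]] by simp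
  finally show "(\<integral>x. of_real (h x) * \<psi> x \<partial>m) = (\<integral>p. of_real (h (snd p)) * \<psi> (?T p) \<partial>(Pr \<Otimes>\<^sub>M m))"
    unfolding \<mu> by (subst (asm) integral_density) (use nonneg in \<open>auto simp: scaleR_conv_of_real\<close>)
qed

section \<open>Unimodular eigenfunctions of a twisted operator\<close>

text \<open>
  This is the eigenvalue equation tested against \<open>cnj (sgn f) * \<psi>\<close>. The conjugate sign turns \<open>f\<close> into
  \<open>\<bar>f\<bar>\<close> on the left, and the free factor \<open>\<psi>\<close> is what later identifies the image of \<open>\<bar>f\<bar>\<close>.
\<close>

lemma unimodular_eigenfunction_dual:
  assumes f: "integrable m f" and a: "a \<in> borel_measurable m" "\<And>x. cmod (a x) = 1"
    and \<zeta>: "cmod \<zeta> = 1"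
    and ev: "AE x in m. annealed_operator Pr L (\<lambda>x. a x * f x) x = \<zeta> * f x"
    and \<psi>: "\<psi> \<in> borel_measurable m" "\<And>x. cmod (\<psi> x) \<le> 1"
  shows "(\<integral>x. of_real (cmod (f x)) * \<psi> x \<partial>m)
    = (\<integral>p. (cnj \<zeta> * (a (snd p) * f (snd p)) * cnj (sgn (f (T (fst p) (snd p)))))
        * \<psi> (T (fst p) (snd p)) \<partial>(Pr \<Otimes>\<^sub>M m))"
proof -
  let ?\<psi> = "\<lambda>x. cnj (sgn (f x)) * \<psi> x"
  note [measurable] = borel_measurable_integrable[OF f] a(1) \<psi>(1)
    borel_measurable_cnj_sgn[OF borel_measurable_integrable[OF f]]
  have af: "integrable m (\<lambda>x. a x * f x)"
    by (rule Bochner_Integration.integrable_bound[OF f]) (use a(2) in \<open>auto simp: norm_mult\<close>)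
  have \<psi>': "?\<psi> \<in> borel_measurable m" "cmod (?\<psi> x) \<le> 1" for x
    using \<psi>(2)[of x] by (auto simp: norm_mult norm_sgn)
  have unit: "cnj \<zeta> * \<zeta> = 1"
    using \<zeta> complex_norm_square[of \<zeta>] by (simp add: mult.commute)
  have "(\<integral>x. of_real (cmod (f x)) * \<psi> x \<partial>m) = (\<integral>x. cnj \<zeta> * (\<zeta> * f x * ?\<psi> x) \<partial>m)"
    using unit by (simp add: mult_cnj_sgn[symmetric] mult.assoc[symmetric])
  also have "\<dots> = cnj \<zeta> * (\<integral>x. \<zeta> * f x * ?\<psi> x \<partial>m)"
    by (rule integral_mult_right_zero)
  also have "(\<integral>x. \<zeta> * f x * ?\<psi> x \<partial>m) = (\<integral>x. annealed_operator Pr L (\<lambda>x. a x * f x) x * ?\<psi> x \<partial>m)"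
    using ev annealed_integrable[OF af] by (intro integral_cong_AE) auto
  also have "cnj \<zeta> * \<dots> = (\<integral>p. cnj \<zeta> * (a (snd p) * f (snd p) * ?\<psi> (T (fst p) (snd p))) \<partial>(Pr \<Otimes>\<^sub>M m))"
    by (simp only: annealed_dual[OF af \<psi>'] integral_mult_right_zero)
  finally show ?thesis
    by (simp add: mult.assoc)
qed

text \<open>
  With \<open>\<psi> = 1\<close> the previous identity compares two integrals over functions whose moduli are ordered
  pointwise, so these functions agree almost everywhere.
\<close>

lemma unimodular_eigenfunction_rigid:
  assumes f: "integrable m f" and a: "a \<in> borel_measurable m" "\<And>x. cmod (a x) = 1"
    and \<zeta>: "cmod \<zeta> = 1"
    and ev: "AE x in m. annealed_operator Pr L (\<lambda>x. a x * f x) x = \<zeta> * f x"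
  shows "AE p in Pr \<Otimes>\<^sub>M m. cnj \<zeta> * (a (snd p) * f (snd p)) * cnj (sgn (f (T (fst p) (snd p))))
    = of_real (cmod (f (snd p)))"
proof (rule AE_eq_of_integral_eq_of_cmod_le)
  let ?w = "\<lambda>p. cnj \<zeta> * (a (snd p) * f (snd p)) * cnj (sgn (f (T (fst p) (snd p))))"
  note [measurable] = borel_measurable_integrable[OF f] a(1)
    borel_measurable_cnj_sgn[OF borel_measurable_integrable[OF f]]
  have le: "cmod (?w p) \<le> cmod (f (snd p))" for p
    using a(2) \<zeta> by (auto simp: norm_mult norm_sgn)
  then show "AE p in Pr \<Otimes>\<^sub>M m. cmod (?w p) \<le> cmod (f (snd p))"
    by simp
  show "integrable (Pr \<Otimes>\<^sub>M m) ?w"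
    by (rule Bochner_Integration.integrable_bound[OF integrable_pair_snd[OF f]]) (use le in auto)
  show "integrable (Pr \<Otimes>\<^sub>M m) (\<lambda>p. cmod (f (snd p)))"
    using integrable_pair_snd[OF f] by simp
  have "complex_of_real (\<integral>p. cmod (f (snd p)) \<partial>(Pr \<Otimes>\<^sub>M m)) = of_real (\<integral>x. cmod (f x) \<partial>m)"
    using integral_fst'[of "\<lambda>p. cmod (f (snd p))"] integrable_pair_snd[OF f] 
    by (simp add: Omega.prob_space)
  then show "(\<integral>p. ?w p \<partial>(Pr \<Otimes>\<^sub>M m)) = of_real (\<integral>p. cmod (f (snd p)) \<partial>(Pr \<Otimes>\<^sub>M m))"
    using unimodular_eigenfunction_dual[OF f a \<zeta> ev, of "\<lambda>_. 1"] by simp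
qed

lemma unimodular_eigenfunction_modulus_fixed:
  assumes f: "integrable m f" and a: "a \<in> borel_measurable m" "\<And>x. cmod (a x) = 1"
    and \<zeta>: "cmod \<zeta> = 1"
    and ev: "AE x in m. annealed_operator Pr L (\<lambda>x. a x * f x) x = \<zeta> * f x"
  shows "AE x in m. annealed_operator Pr L (\<lambda>x. of_real (cmod (f x))) x = of_real (cmod (f x))"
proof (rule annealed_eqI)
  fix \<psi> :: "'x \<Rightarrow> complex" assume \<psi>: "\<psi> \<in> borel_measurable m" "\<And>x. cmod (\<psi> x) \<le> 1"
  note [measurable] = borel_measurable_integrable[OF f] a(1) \<psi>(1)
    borel_measurable_cnj_sgn[OF borel_measurable_integrable[OF f]]
  show "(\<integral>x. of_real (cmod (f x)) * \<psi> x \<partial>m)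
      = (\<integral>p. of_real (cmod (f (snd p))) * \<psi> (T (fst p) (snd p)) \<partial>(Pr \<Otimes>\<^sub>M m))"
    unfolding unimodular_eigenfunction_dual[OF f a \<zeta> ev \<psi>]
    by (rule integral_cong_AE)
      (use unimodular_eigenfunction_rigid[OF f a \<zeta> ev] in \<open>auto elim!: eventually_mono\<close>)
qed (use f in auto)

end

section \<open>Simplicity of the eigenvalue one\<close>

context annealed_system
begin

lemma annealed_in_B: "f \<in> B \<Longrightarrow> annealed_operator Pr L f \<in> B"
  using P_B by blast

text \<open>
  In the spectral decomposition of a fixed function, the component in the complement \<open>F\<close> is also fixed
  (up to a null set), and \<open>1 - P\<close> is injective on \<open>F\<close>. So the fixed functions all lie in the
  one-dimensional spectral subspace \<open>E\<close>.
\<close>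

lemma fixed_functions_one_dimensional:
  "\<exists>b. \<forall>f\<in>B. (AE x in m. annealed_operator Pr L f x = f x) \<longrightarrow> (\<exists>c. AE x in m. f x = c * b x)"
proof -
  let ?A = "annealed_operator Pr L"
  note V = B_banach
  obtain E F where E: "E \<subseteq> B" and F: "F \<subseteq> B"
    and split: "\<forall>f\<in>B. \<exists>a\<in>E. \<exists>b\<in>F. nrm (\<lambda>x. f x - (a x + b x)) = 0"
    and dim: "has_dim E nrm 1"
    and nil: "\<forall>f\<in>E. nrm ((op_shift ?A 1 ^^ 1) f) = 0"
    and res: "1 \<in> resolvent_set F nrm ?A"
    using one_simple_isolated(2) unfolding has_algebraic_multiplicity_def by blast
  obtain b :: "nat \<Rightarrow> 'x \<Rightarrow> complex" where "\<forall>i<1. b i \<in> E"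
    and b_spans: "\<forall>f\<in>E. \<exists>c. nrm (\<lambda>x. f x - (\<Sum>i<1. c i * b i x)) = 0"
    using dim unfolding has_dim_def by blast
  then have b: "b 0 \<in> B"
    using E by auto
  obtain c where c: "\<forall>f\<in>F. nrm f \<le> c * nrm (op_shift ?A 1 f)"
    using res unfolding resolvent_set_def by blast
  have shift_in: "op_shift ?A 1 f \<in> B" if "f \<in> B" for f
    using banach_in_L1_diff[OF V that annealed_in_B[OF that]] by (simp add: op_shift_def)
  have "\<exists>c. AE x in m. f x = c * b 0 x" if f: "f \<in> B" and fixed: "AE x in m. ?A f x = f x" for f
  proof -
    obtain u v where u: "u \<in> E" and v: "v \<in> F" and uv: "nrm (\<lambda>x. f x - (u x + v x)) = 0"
      using split f by blast
    have uB: "u \<in> B" and vB: "v \<in> B"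
      using u v E F by auto
    note int = banach_in_L1_integrable[OF V f] banach_in_L1_integrable[OF V uB]
      banach_in_L1_integrable[OF V vB]
    have uvB: "(\<lambda>x. u x + v x) \<in> B"
      by (rule banach_in_L1_add[OF V uB vB])
    have f_uv: "AE x in m. f x = u x + v x"
      using uv banach_in_L1_null[OF V banach_in_L1_diff[OF V f uvB]] by simp
    have u_fix: "AE x in m. ?A u x = u x"
      using nil u banach_in_L1_null[OF V shift_in[OF uB]] by (auto simp: op_shift_def)
    have "AE x in m. op_shift ?A 1 v x = 0"
      using annealed_cong[OF int(1) banach_in_L1_integrable[OF V uvB] f_uv]
        annealed_add[OF int(2,3)] f_uv u_fix fixed
      by eventually_elim (simp add: op_shift_def)
    then have "nrm (op_shift ?A 1 v) = 0"
      using banach_in_L1_null[OF V shift_in[OF vB]] by simp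
    then have "nrm v = 0"
      using c v banach_in_L1_nonneg[OF V vB] by force
    then have v0: "AE x in m. v x = 0"
      using banach_in_L1_null[OF V vB] by simp
    obtain d where "nrm (\<lambda>x. u x - (\<Sum>i<1. d i * b i x)) = 0"
      using b_spans u by blast
    then have "AE x in m. u x - d 0 * b 0 x = 0"
      using banach_in_L1_null[OF V banach_in_L1_diff[OF V uB banach_in_L1_scale[OF V b]]] by simp
    with f_uv v0 have "AE x in m. f x = d 0 * b 0 x"
      by eventually_elim simp
    then show ?thesis ..
  qed
  then show ?thesis
    by blast
qed

lemma fixed_functions_proportional:
  assumes f: "f \<in> B" "AE x in m. annealed_operator Pr L f x = f x"
    and h: "h \<in> B" "AE x in m. annealed_operator Pr L h x = h x" "\<not> (AE x in m. h x = 0)"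
  shows "\<exists>c. AE x in m. f x = c * h x"
proof -
  obtain b c d where c: "AE x in m. f x = c * b x" and d: "AE x in m. h x = d * b x"
    using fixed_functions_one_dimensional f h by metis
  have "d \<noteq> 0"
    using d h(3) by auto
  from c d have "AE x in m. f x = (c / d) * h x"
    by eventually_elim (use \<open>d \<noteq> 0\<close> in simp)
  then show ?thesis ..
qed

end

section \<open>Failure of aperiodicity\<close>

text \<open>
  The multiplier space \<open>B0\<close> provides multiplication by \<open>\<phi>\<close>, but need not contain its exponential;
  the latter acts on \<open>B\<close> through the exponential series.
\<close>

lemma (in annealed_system) twisted_in_B:
  assumes \<phi>: "(\<lambda>x. complex_of_real (\<phi> x)) \<in> B0" and f: "f \<in> B"
  shows "(\<lambda>x. exp (z * of_real (\<phi> x)) * f x) \<in> B"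
proof -
  obtain C where C: "C > 0" "\<And>f g. f \<in> B0 \<Longrightarrow> g \<in> B \<Longrightarrow> (\<lambda>x. f x * g x) \<in> B"
    "\<And>f g. f \<in> B0 \<Longrightarrow> g \<in> B \<Longrightarrow> nrm (\<lambda>x. f x * g x) \<le> C * nrm0 f * nrm g"
    using B0_multiplier by blast
  let ?K = "cmod z * (C * nrm0 (\<lambda>x. complex_of_real (\<phi> x)))"
  show ?thesis
  proof (rule exp_multiplier[OF B_banach B_compact _ _ _ f, where K = ?K])
    show "(\<lambda>x. z * of_real (\<phi> x)) \<in> borel_measurable m"
      using borel_measurable_integrable[OF banach_in_L1_integrable[OF B0_banach \<phi>]] by measurable
    show "0 \<le> ?K"
      using C(1) banach_in_L1_nonneg[OF B0_banach \<phi>] by simp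
    fix g assume g: "g \<in> B"
    show "(\<lambda>x. z * of_real (\<phi> x) * g x) \<in> B \<and> nrm (\<lambda>x. z * of_real (\<phi> x) * g x) \<le> ?K * nrm g"
      using banach_in_L1_scale[OF B_banach C(2)[OF \<phi> g], of z]
        banach_in_L1_norm_scale[OF B_banach C(2)[OF \<phi> g], of z]
        mult_left_mono[OF C(3)[OF \<phi> g], of "cmod z"]
      by (simp add: mult.assoc)
  qed
qed

theorem proposition3p17:
  fixes Pr :: "'w measure" and m \<mu> :: "'x measure"
    and T :: "'w \<Rightarrow> 'x \<Rightarrow> 'x"
    and L :: "'w \<Rightarrow> ('x \<Rightarrow> complex) \<Rightarrow> 'x \<Rightarrow> complex"
    and B B0 :: "('x \<Rightarrow> complex) set" and nrm nrm0 :: "('x \<Rightarrow> complex) \<Rightarrow> real"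
    and h \<phi> :: "'x \<Rightarrow> real"
  assumes "annealed_system Pr m T L B nrm B0 nrm0"
    and "stationary_measure Pr m T \<mu>"
    and "h \<in> borel_measurable m" and "AE x in m. 0 \<le> h x"
    and "\<mu> = density m (\<lambda>x. ennreal (h x))"
    and "(\<lambda>x. complex_of_real (h x)) \<in> B"
    and "(\<lambda>x. complex_of_real (\<phi> x)) \<in> B0"
    and "bounded (\<phi> ` space m)"
    and "(\<integral>x. \<phi> x \<partial>\<mu>) = 0"
    and "absolutely_continuous m \<mu>" and "absolutely_continuous \<mu> m"
    and "\<And>t::real. op_spectral_radius B nrm (twisted_operator Pr L \<phi> (\<i> * of_real t)) \<le> 1"
    and "\<And>t::real. op_essential_spectral_radius B nrm (twisted_operator Pr L \<phi> (\<i> * of_real t)) < 1"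
    and "\<not> aperiodic Pr L B nrm \<phi>"
  shows "\<exists>(t::real) (\<zeta>::complex) (g :: 'x \<Rightarrow> complex).
           t \<noteq> 0 \<and> cmod \<zeta> = 1 \<and> g \<in> borel_measurable m \<and> \<not> (AE x in m. g x = 0) \<and>
           (\<lambda>x. g x * complex_of_real (h x)) \<in> B \<and>
           (AE (\<omega>, x) in Pr \<Otimes>\<^sub>M m. \<zeta> * g (T \<omega> x) = exp (\<i> * of_real t * of_real (\<phi> x)) * g x)"
proof -
  interpret annealed_system Pr m T L B nrm B0 nrm0
    by fact
  note V = B_banach
  obtain t where "t \<noteq> 0"
    and radius: "\<not> op_spectral_radius B nrm (twisted_operator Pr L \<phi> (\<i> * of_real t)) < 1"
    using assms(14) unfolding aperiodic_def by blast
  define P where "P = twisted_operator Pr L \<phi> (\<i> * of_real t)"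
  define a where "a x = exp (\<i> * of_real t * of_real (\<phi> x))" for x
  have P_eq: "P f = annealed_operator Pr L (\<lambda>x. a x * f x)" for f
    by (simp add: P_def a_def twisted_operator_def)
  have P_in: "P f \<in> B" if "f \<in> B" for f
    unfolding P_eq a_def by (intro annealed_in_B twisted_in_B assms(7) that)
  have "op_spectral_radius B nrm P = 1"
    using assms(12)[of t] radius unfolding P_def by simp
  then obtain \<zeta> where \<zeta>: "cmod \<zeta> = 1" and "op_eigenvalue B nrm P \<zeta>"
    using unimodular_eigenvalue[where A = P, OF V P_in] assms(13)[of t] unfolding P_def by blast
  then obtain f where f: "f \<in> B" and "nrm f \<noteq> 0" and "nrm (op_shift P \<zeta> f) = 0"
    unfolding op_eigenvalue_def by blast
  have f_nz: "\<not> (AE x in m. f x = 0)"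
    using \<open>nrm f \<noteq> 0\<close> banach_in_L1_null[OF V f] by simp
  have "op_shift P \<zeta> f \<in> B"
    unfolding op_shift_def
    by (rule banach_in_L1_diff[OF V banach_in_L1_scale[OF V f] P_in[OF f]])
  then have ev: "AE x in m. annealed_operator Pr L (\<lambda>x. a x * f x) x = \<zeta> * f x"
    using \<open>nrm (op_shift P \<zeta> f) = 0\<close> banach_in_L1_null[OF V]
    unfolding op_shift_def P_eq by fastforce
  have a: "a \<in> borel_measurable m" "cmod (a x) = 1" for x
  proof -
    have "\<phi> \<in> borel_measurable m"
      using integrable_Re[OF banach_in_L1_integrable[OF B0_banach assms(7)]] by simp
    then show "a \<in> borel_measurable m"
      unfolding a_def by measurable
    show "cmod (a x) = 1"
      using norm_exp_i_times[of "t * \<phi> x"] by (simp add: a_def mult.assoc)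
  qed
  note f_int = banach_in_L1_integrable[OF V f]
  have h_pos: "AE x in m. h x > 0"
  proof -
    have "AE x in \<mu>. h x > 0"
      unfolding assms(5) using assms(3) by (subst AE_density) auto
    then show ?thesis
      using absolutely_continuous_AE[OF _ assms(11)] unfolding assms(5) by simp
  qed
  have h_nz: "\<not> (AE x in m. complex_of_real (h x) = 0)"
  proof
    assume "AE x in m. complex_of_real (h x) = 0"
    with h_pos have "AE x in m. False"
      by eventually_elim simp
    then show False
      by simp
  qed
  have "(\<lambda>x. complex_of_real (cmod (f x))) \<in> B"
    using B_lattice[OF f] by simp
  then obtain c where c: "AE x in m. complex_of_real (cmod (f x)) = c * complex_of_real (h x)"
    using fixed_functions_proportional[OF _ unimodular_eigenfunction_modulus_fixed[OF f_int a \<zeta> ev]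
      assms(6) stationary_density_fixed[OF assms(2,5) banach_in_L1_integrable[OF V assms(6)] assms(3,4)]
      h_nz] by blast
  have "c \<noteq> 0"
    using c f_nz by auto
  have f_pos: "AE x in m. f x \<noteq> 0"
    using c h_pos by eventually_elim (use \<open>c \<noteq> 0\<close> in auto)
  \<comment> \<open>Off a null set this is \<open>f / \<bar>f\<bar> = f / (c h)\<close>, so \<open>g\<close> times \<open>h\<close> is a multiple of \<open>f\<close>.\<close>
  define g where "g x = sgn (f x)" for x
  have [measurable]: "f \<in> borel_measurable m"
    using f_int by simp
  have g_meas: "g \<in> borel_measurable m"
    unfolding g_def by measurable
  have "\<not> (AE x in m. g x = 0)"
    using f_nz by (simp add: g_def sgn_zero_iff)
  moreover have "(\<lambda>x. g x * complex_of_real (h x)) \<in> B"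
  proof (rule banach_in_L1_cong[OF V banach_in_L1_scale[OF V f, of "inverse c"]])
    show "(\<lambda>x. g x * complex_of_real (h x)) \<in> borel_measurable m"
      using g_meas assms(3) by measurable
    show "AE x in m. g x * complex_of_real (h x) = inverse c * f x"
      using c
    proof eventually_elim
      case (elim x)
      have "f x = g x * of_real (cmod (f x))"
        by (simp add: g_def sgn_eq)
      then show ?case
        using elim \<open>c \<noteq> 0\<close> by (simp add: field_simps)
    qed
  qed
  moreover have "AE (\<omega>, x) in Pr \<Otimes>\<^sub>M m. \<zeta> * g (T \<omega> x) = exp (\<i> * of_real t * of_real (\<phi> x)) * g x"
  proof -
    have "AE p in Pr \<Otimes>\<^sub>M m. f (snd p) \<noteq> 0"
      by (rule AE_pair_snd[OF _ f_pos]) measurable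
    with unimodular_eigenfunction_rigid[OF f_int a \<zeta> ev]
    have "AE p in Pr \<Otimes>\<^sub>M m. \<zeta> * g (T (fst p) (snd p)) = a (snd p) * g (snd p)"
    proof eventually_elim
      case (elim p)
      let ?x = "snd p" and ?y = "T (fst p) (snd p)"
      have x: "f ?x = of_real (cmod (f ?x)) * g ?x"
        by (simp add: g_def sgn_eq)
      have "of_real (cmod (f ?x)) * (cnj \<zeta> * (a ?x * g ?x) * cnj (g ?y)) = of_real (cmod (f ?x)) * 1"
        using elim(1) by (subst (asm) x) (simp add: g_def mult_ac)
      then have one: "cnj \<zeta> * (a ?x * g ?x) * cnj (g ?y) = 1"
        using elim(2) by simp
      \<comment> \<open>The identity itself shows that \<open>f\<close> does not vanish at \<open>T \<omega> x\<close>.\<close>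
      then have "g ?y \<noteq> 0"
        by auto
      then have "cmod (g ?y) = 1"
        by (auto simp: g_def norm_sgn sgn_zero_iff)
      then have y: "cnj (g ?y) * g ?y = 1" and z: "\<zeta> * cnj \<zeta> = 1"
        using \<zeta> complex_norm_square[of \<zeta>] complex_norm_square[of "g ?y"]
        by (simp_all add: mult.commute)
      have "\<zeta> * g ?y = \<zeta> * g ?y * (cnj \<zeta> * (a ?x * g ?x) * cnj (g ?y))"
        by (simp add: one)
      also have "\<dots> = (\<zeta> * cnj \<zeta>) * (cnj (g ?y) * g ?y) * (a ?x * g ?x)"
        by (simp add: mult_ac)
      finally show ?case
        by (simp add: y z)
    qed
    then show ?thesis
      by (simp add: case_prod_beta' a_def)
  qed
  ultimately show ?thesis
    using \<open>t \<noteq> 0\<close> \<zeta> g_meas by blast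
qed

end
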